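(* Unless $\mathrm{P}=\mathrm{NP}$, there is no algorithm and polynomial $p$ such that, for every risk measure $\rho$ given as an oracle, the algorithm solves every instance of the Stochastic $\rho$-Shortest Path Problem in time at most $p$ of the instance size (i.e. with a complexity function independent of $\rho$).
   Context: A risk measure $\rho$ is a map from random variables (here, $\mathbb{Z}_+$-valued random variables with finite support) to real numbers; it is accessed as an oracle that returns $\rho(Y)$ for a given distribution $Y$. Stochastic $\rho$-Shortest Path Problem: an instance consists of a directed graph $D=(V,A)$ without loops, two vertices $o,d\in V$, and independent random variables $(X_a)_{a\in A}$, each taking values in $\mathbb{Z}_+$ with finite support, each encoded by its support and the probability of each value in the support. A solution is an elementary $o$-$d$ path $P$, and the objective is to minimize $\rho\bigl(\sum_{a\in P}X_a\bigr)$. *)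

theory Defs
  imports
    "HOL-Probability.Product_PMF"
    "HOL-Computational_Algebra.Polynomial"
    "Graph_Theory.Arc_Walk"
begin

section \<open>Machines\<close>

text \<open>
  One machine model serves both for ordinary Turing machines and for algorithms that query a
  real-valued function. A machine is a deterministic multi-tape Turing machine whose tapes are
  two-way infinite; besides finitely many tapes over a finite alphabet, it may have finitely many
  tapes whose cells hold real numbers. Real numbers can only be compared and combined
  by exact arithmetic (no rounding), at unit cost, as in the real RAM model. In one step, the
  operation \<open>Ask\<close> delivers the exact value of the queried function at the word
  currently written on the query tape. A machine without real tapes is an ordinary multi-tape
  Turing machine, which can neither store nor observe an answer.
\<close>

datatype dir = Left | Stay | Right

text \<open>
  The value to be written to the scanned cell of a real tape, in terms of the values of the
  cells scanned on the real tapes (identified by their index) at the beginning of the step.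
\<close>

datatype 'i real_op =
  Const rat
| Copy 'i
| Plus 'i 'i
| Minus 'i 'i
| Times 'i 'i
| Divide 'i 'i
| Ask

text \<open>
  States are the numbers below \<open>n_states\<close>; state 0 is initial and state 1 is halting. Symbols
  are the numbers below \<open>n_syms\<close>; 0 is the blank, 1 and 2 stand for the bits \<open>False\<close> and \<open>True\<close>.
  Tapes 0, 1 and 2 are the input, output and query tapes. The transition function gets
  the state, the scanned symbols and the outcomes of all comparisons between scanned reals; its
  values outside of this finite domain are irrelevant.
\<close>

record machine =
  n_states :: nat
  n_syms :: nat
  n_tapes :: nat
  n_real_tapes :: nat
  delta :: "nat \<Rightarrow> nat list \<Rightarrow> bool list \<Rightarrow>
    nat \<times> (nat \<times> dir) list \<times> (nat real_op \<times> dir) list"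

definition wf_machine :: "machine \<Rightarrow> bool" where
  "wf_machine M \<longleftrightarrow>
     n_states M \<ge> 2 \<and> n_syms M \<ge> 3 \<and> n_tapes M \<ge> 3 \<and>
     (\<forall>q ss cs q' as bs.
        q < n_states M \<longrightarrow>
        length ss = n_tapes M \<longrightarrow> set ss \<subseteq> {..<n_syms M} \<longrightarrow>
        length cs = n_real_tapes M * n_real_tapes M \<longrightarrow>
        delta M q ss cs = (q', as, bs) \<longrightarrow>
          q' < n_states M \<and>
          length as = n_tapes M \<and> (\<forall>(s, m) \<in> set as. s < n_syms M) \<and>
          length bs = n_real_tapes M \<and>
          (\<forall>(e, m) \<in> set bs. set_real_op e \<subseteq> {..<n_real_tapes M}))"

type_synonym 'c tape = "(int \<Rightarrow> 'c) \<times> int"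

record config =
  state :: nat
  tapes :: "nat tape list"
  real_tapes :: "real tape list"

fun scan :: "'c tape \<Rightarrow> 'c" where
  "scan (f, h) = f h"

fun move :: "dir \<Rightarrow> int \<Rightarrow> int" where
  "move Left h = h - 1"
| "move Stay h = h"
| "move Right h = h + 1"

fun write_move :: "'c \<Rightarrow> dir \<Rightarrow> 'c tape \<Rightarrow> 'c tape" where
  "write_move c m (f, h) = (f(h := c), move m h)"

definition bit_symbol :: "bool \<Rightarrow> nat" where
  "bit_symbol b = (if b then 2 else 1)"

definition word_tape :: "bool list \<Rightarrow> nat tape" where
  "word_tape w =
     (\<lambda>i. if 0 \<le> i \<and> nat i < length w then bit_symbol (w ! nat i) else 0, 0)"

text \<open>
  The word on a tape is the longest block of bits starting in cell 0. (On tapes arising in a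
  computation, only finitely many cells are not blank.)
\<close>

definition tape_word :: "nat tape \<Rightarrow> bool list" where
  "tape_word t =
     map (\<lambda>i. fst t (int i) = bit_symbol True)
       [0..<(LEAST n. fst t (int n) \<notin> range bit_symbol)]"

fun eval_op :: "real \<Rightarrow> real list \<Rightarrow> nat real_op \<Rightarrow> real" where
  "eval_op a rs (Const c) = real_of_rat c"
| "eval_op a rs (Copy i) = rs ! i"
| "eval_op a rs (Plus i j) = rs ! i + rs ! j"
| "eval_op a rs (Minus i j) = rs ! i - rs ! j"
| "eval_op a rs (Times i j) = rs ! i * rs ! j"
| "eval_op a rs (Divide i j) = rs ! i / rs ! j"
| "eval_op a rs Ask = a"

definition step :: "machine \<Rightarrow> (bool list \<Rightarrow> real) \<Rightarrow> config \<Rightarrow> config" where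
  "step M f c =
     (if state c = 1 then c
      else
        let rs = map scan (real_tapes c);
            cs = [x \<le> y. x \<leftarrow> rs, y \<leftarrow> rs];
            (q', as, bs) = delta M (state c) (map scan (tapes c)) cs;
            a = f (tape_word (tapes c ! 2))
        in \<lparr> state = q',
             tapes = map2 (\<lambda>(s, m) t. write_move s m t) as (tapes c),
             real_tapes =
               map2 (\<lambda>(e, m) t. write_move (eval_op a rs e) m t) bs (real_tapes c) \<rparr>)"

definition initial :: "machine \<Rightarrow> bool list \<Rightarrow> config" where
  "initial M w =
     \<lparr> state = 0,
       tapes = word_tape w # replicate (n_tapes M - 1) (word_tape []),
       real_tapes = replicate (n_real_tapes M) (\<lambda>_. 0, 0) \<rparr>"

definition outputs_within ::
    "machine \<Rightarrow> (bool list \<Rightarrow> real) \<Rightarrow> bool list \<Rightarrow> nat \<Rightarrow> bool list \<Rightarrow> bool" where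
  "outputs_within M f w t out \<longleftrightarrow>
     (let c = (step M f ^^ t) (initial M w) in state c = 1 \<and> tape_word (tapes c ! 1) = out)"


section \<open>The classes P and NP\<close>

text \<open>The queried function in the following definition is immaterial: there are no real tapes.\<close>

definition class_P :: "bool list set set" where
  "class_P =
     {L. \<exists>M (p :: nat poly). wf_machine M \<and> n_real_tapes M = 0 \<and>
           (\<forall>w. outputs_within M (\<lambda>_. 0) w (poly p (length w)) [w \<in> L])}"

fun enc_list :: "('b \<Rightarrow> bool list) \<Rightarrow> 'b list \<Rightarrow> bool list" where
  "enc_list enc [] = [False]"
| "enc_list enc (x # xs) = True # enc x @ enc_list enc xs"

definition enc_word_pair :: "bool list \<Rightarrow> bool list \<Rightarrow> bool list" where
  "enc_word_pair w y = enc_list (\<lambda>b. [b]) w @ y"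

definition class_NP :: "bool list set set" where
  "class_NP =
     {L. \<exists>L' \<in> class_P. \<exists>p :: nat poly.
           \<forall>w. w \<in> L \<longleftrightarrow> (\<exists>y. length y \<le> poly p (length w) \<and> enc_word_pair w y \<in> L')}"


section \<open>Instances of the problem\<close>

text \<open>
  A distribution on the natural numbers with finite support (and rational probabilities, so that
  it can be encoded) is given by listing the values in its support with their probabilities.
\<close>

type_synonym dist = "(nat \<times> rat) list"

definition valid_dist :: "dist \<Rightarrow> bool" where
  "valid_dist D \<longleftrightarrow>
     distinct (map fst D) \<and> (\<forall>(k, q) \<in> set D. q > 0) \<and> sum_list (map snd D) = 1"

definition law :: "dist \<Rightarrow> nat pmf" where
  "law D = pmf_of_list (map (\<lambda>(k, q). (k, real_of_rat q)) D)"

text \<open>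
  Arcs are identified by their position in \<open>arc_data\<close>, which lists their tails, their heads and
  the distributions of their random variables. Thus parallel arcs may occur.
\<close>

record instnc =
  vertices :: "nat list"
  arc_data :: "(nat \<times> nat \<times> dist) list"
  origin :: nat
  destination :: nat

definition graph_of :: "instnc \<Rightarrow> (nat, nat) pre_digraph" where
  "graph_of I =
     \<lparr> verts = set (vertices I),
       arcs = {..<length (arc_data I)},
       tail = (\<lambda>a. fst (arc_data I ! a)),
       head = (\<lambda>a. fst (snd (arc_data I ! a))) \<rparr>"

definition arc_law :: "instnc \<Rightarrow> nat \<Rightarrow> nat pmf" where
  "arc_law I a = law (snd (snd (arc_data I ! a)))"

definition valid_instance :: "instnc \<Rightarrow> bool" where
  "valid_instance I \<longleftrightarrow>
     distinct (vertices I) \<and>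
     fin_digraph (graph_of I) \<and> loopfree_digraph (graph_of I) \<and>
     origin I \<in> verts (graph_of I) \<and> destination I \<in> verts (graph_of I) \<and>
     (\<forall>(u, v, D) \<in> set (arc_data I). valid_dist D)"

definition is_solution :: "instnc \<Rightarrow> nat list \<Rightarrow> bool" where
  "is_solution I P \<longleftrightarrow> pre_digraph.apath (graph_of I) (origin I) P (destination I)"

text \<open>The joint distribution of the independent random variables is the product distribution.\<close>

definition path_law :: "instnc \<Rightarrow> nat list \<Rightarrow> nat pmf" where
  "path_law I P =
     map_pmf (\<lambda>X. \<Sum>a\<in>set P. X a) (Pi_pmf (arcs (graph_of I)) 0 (arc_law I))"

text \<open>
  Risk measures are real-valued functions of the distribution; only their values at
  distributions with finite support matter.
\<close>

type_synonym risk_measure = "nat pmf \<Rightarrow> real"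

definition is_optimal :: "risk_measure \<Rightarrow> instnc \<Rightarrow> nat list \<Rightarrow> bool" where
  "is_optimal \<rho> I P \<longleftrightarrow> is_arg_min (\<lambda>P. \<rho> (path_law I P)) (is_solution I) P"


section \<open>Encodings\<close>

text \<open>
  All encodings are self-delimiting; numbers are written in binary, least significant bit first,
  where each bit is preceded by the continuation mark \<open>True\<close>.
\<close>

fun enc_nat :: "nat \<Rightarrow> bool list" where
  "enc_nat n = (if n = 0 then [False] else True # odd n # enc_nat (n div 2))"

declare enc_nat.simps [simp del]

text \<open>Only used for nonnegative numbers.\<close>

definition enc_rat :: "rat \<Rightarrow> bool list" where
  "enc_rat q = enc_nat (nat (fst (quotient_of q))) @ enc_nat (nat (snd (quotient_of q)))"

definition enc_dist :: "dist \<Rightarrow> bool list" where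
  "enc_dist = enc_list (\<lambda>(k, q). enc_nat k @ enc_rat q)"

definition enc_instance :: "instnc \<Rightarrow> bool list" where
  "enc_instance I =
     enc_list enc_nat (vertices I) @
     enc_list (\<lambda>(u, v, D). enc_nat u @ enc_nat v @ enc_dist D) (arc_data I) @
     enc_nat (origin I) @ enc_nat (destination I)"

text \<open>An output is a path or the statement that there is none.\<close>

fun enc_output :: "nat list option \<Rightarrow> bool list" where
  "enc_output None = [False]"
| "enc_output (Some P) = True # enc_list enc_nat P"

text \<open>
  The encoding of distributions is injective, so that a query determines the distribution.
\<close>

lemma enc_nat_0: "enc_nat 0 = [False]"
  by (subst enc_nat.simps) simp

lemma enc_nat_nonzero: "n \<noteq> 0 \<Longrightarrow> enc_nat n = True # odd n # enc_nat (n div 2)"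
  by (subst enc_nat.simps) simp

lemma enc_nat_append_eq_iff: "enc_nat m @ x = enc_nat n @ y \<longleftrightarrow> m = n \<and> x = y"
proof (induction m arbitrary: n rule: less_induct)
  case (less m)
  consider "m = 0" "n = 0" | "m = 0" "n \<noteq> 0" | "m \<noteq> 0" "n = 0" | "m \<noteq> 0" "n \<noteq> 0"
    by blast
  then show ?case
  proof cases
    case 4
    have "enc_nat (m div 2) @ x = enc_nat (n div 2) @ y \<longleftrightarrow> m div 2 = n div 2 \<and> x = y"
      using 4 by (intro less) simp
    moreover have "m = n \<longleftrightarrow> odd m = odd n \<and> m div 2 = n div 2"
      by presburger
    ultimately show ?thesis
      unfolding enc_nat_nonzero[OF 4(1)] enc_nat_nonzero[OF 4(2)] append_Cons list.inject by blast
  qed (simp_all add: enc_nat_0 enc_nat_nonzero)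
qed

lemma enc_rat_append_eq_iff:
  assumes "q \<ge> 0" "r \<ge> 0"
  shows "enc_rat q @ x = enc_rat r @ y \<longleftrightarrow> q = r \<and> x = y"
proof -
  have nonneg: "fst (quotient_of s) \<ge> 0 \<and> snd (quotient_of s) \<ge> 0" if "s \<ge> 0" for s :: rat
  proof -
    obtain a b where ab: "quotient_of s = (a, b)"
      by force
    then have b: "b > 0" and s: "s = of_int a / of_int b"
      using quotient_of_denom_pos quotient_of_div by blast+
    have "of_int a = s * of_int b"
      using b s by simp
    then have "(of_int a :: rat) \<ge> 0"
      using b that by simp
    then show ?thesis
      using ab b by simp
  qed
  have "q = r \<longleftrightarrow> fst (quotient_of q) = fst (quotient_of r) \<and>
      snd (quotient_of q) = snd (quotient_of r)"
    by (metis prod_eq_iff quotient_of_inject)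
  then show ?thesis
    using nonneg[OF assms(1)] nonneg[OF assms(2)]
    by (auto simp: enc_rat_def enc_nat_append_eq_iff nat_eq_iff)
qed

lemma enc_dist_inject:
  assumes "valid_dist D" "valid_dist E" "enc_dist D = enc_dist E"
  shows "D = E"
proof -
  have "D = E" if "\<forall>(k, q) \<in> set D. q > 0" "\<forall>(k, q) \<in> set E. q > 0" "enc_dist D = enc_dist E"
    using that
  proof (induction D arbitrary: E)
    case Nil
    then show ?case
      by (cases E) (simp_all add: enc_dist_def)
  next
    case (Cons a D)
    obtain k q where a: "a = (k, q)"
      by force
    obtain l r E' where E: "E = (l, r) # E'"
      using Cons.prems(3) by (cases E) (auto simp: enc_dist_def a)
    have "q \<ge> 0" "r \<ge> 0"
      using Cons.prems(1,2) by (auto simp: a E)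
    then have "k = l \<and> q = r \<and> enc_dist D = enc_dist E'"
      using Cons.prems(3)
      by (simp add: a E enc_dist_def enc_nat_append_eq_iff enc_rat_append_eq_iff)
    moreover have "D = E'"
      using Cons.prems(1,2) calculation by (intro Cons.IH) (auto simp: E)
    ultimately show ?case
      by (simp add: a E)
  qed
  then show ?thesis
    using assms by (simp add: valid_dist_def)
qed


section \<open>Solving the problem with access to a risk measure\<close>

text \<open>Queries that do not encode a distribution are answered by 0.\<close>

definition risk_query :: "risk_measure \<Rightarrow> bool list \<Rightarrow> real" where
  "risk_query \<rho> w =
     (if \<exists>D. valid_dist D \<and> enc_dist D = w
      then \<rho> (law (THE D. valid_dist D \<and> enc_dist D = w))
      else 0)"

definition solves_within :: "machine \<Rightarrow> risk_measure \<Rightarrow> instnc \<Rightarrow> nat \<Rightarrow> bool" where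
  "solves_within M \<rho> I t \<longleftrightarrow>
     (\<exists>r. outputs_within M (risk_query \<rho>) (enc_instance I) t (enc_output r) \<and>
        (case r of
           Some P \<Rightarrow> is_optimal \<rho> I P
         | None \<Rightarrow> \<nexists>P. is_solution I P))"

end

(* The algorithm sees a risk measure only through its values at the laws it queries, at most one
   per step. In a chain of n pairs of parallel arcs, where the i-th pair carries the constants 0
   and 2^i, there are 2^n paths with pairwise distinct laws, while the instance has size O(n^2).
   Run the algorithm on the zero risk measure. For large n, some path has a law that is neither
   queried nor the law of the returned path. Giving this law the risk -1 does not change the
   run, but makes its output suboptimal. *)

theory Submission
  imports Defs "HOL-Real_Asymp.Real_Asymp"
begin

section \<open>Queries of a machine\<close>

lemma step_cong:
  assumes "f (tape_word (tapes c ! 2)) = g (tape_word (tapes c ! 2))"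
  shows "step M f c = step M g c"
  using assms by (simp add: step_def)

text \<open>The query word of each of the first \<open>t\<close> steps counts, whether or not
  \<open>Ask\<close> is performed there. All words whose values can influence the run are thus
  covered, still at most one per step.\<close>

definition queries :: "machine \<Rightarrow> (bool list \<Rightarrow> real) \<Rightarrow> bool list \<Rightarrow> nat \<Rightarrow> bool list set" where
  "queries M f w t = (\<lambda>i. tape_word (tapes ((step M f ^^ i) (initial M w)) ! 2)) ` {..<t}"

lemma finite_queries: "finite (queries M f w t)"
  by (simp add: queries_def)

lemma card_queries: "card (queries M f w t) \<le> t"
  unfolding queries_def by (rule order.trans[OF card_image_le]) simp_all

text \<open>By induction both runs reach the same configuration, hence show the same query word, on
  which \<open>f\<close> and \<open>g\<close> agree.\<close>

lemma run_cong:
  assumes "\<And>v. v \<in> queries M f w t \<Longrightarrow> f v = g v"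
  shows "(step M f ^^ t) (initial M w) = (step M g ^^ t) (initial M w)"
  using assms
proof (induction t)
  case (Suc t)
  have "(step M f ^^ t) (initial M w) = (step M g ^^ t) (initial M w)"
    using Suc.prems by (intro Suc.IH) (auto simp: queries_def)
  moreover have "f (tape_word (tapes ((step M f ^^ t) (initial M w)) ! 2)) =
      g (tape_word (tapes ((step M f ^^ t) (initial M w)) ! 2))"
    using Suc.prems by (auto simp: queries_def)
  ultimately show ?case
    by (simp add: step_cong[of f _ g])
qed simp

lemma outputs_within_cong:
  assumes "\<And>v. v \<in> queries M f w t \<Longrightarrow> f v = g v"
  shows "outputs_within M f w t out \<longleftrightarrow> outputs_within M g w t out"
  using run_cong[OF assms] by (simp add: outputs_within_def)

lemma outputs_within_unique:
  "outputs_within M f w t out \<Longrightarrow> outputs_within M f w t out' \<Longrightarrow> out = out'"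
  by (simp add: outputs_within_def Let_def)


section \<open>Encodings\<close>

lemma inj_enc_list_enc_nat: "enc_list enc_nat xs = enc_list enc_nat ys \<Longrightarrow> xs = ys"
proof (induction xs arbitrary: ys)
  case Nil
  then show ?case
    by (cases ys) simp_all
next
  case (Cons x xs)
  then show ?case
    by (cases ys) (auto simp: enc_nat_append_eq_iff)
qed

lemma inj_enc_output: "enc_output r = enc_output s \<Longrightarrow> r = s"
  by (cases r; cases s) (auto dest: inj_enc_list_enc_nat)

text \<open>Each of the at most \<open>b\<close> binary digits costs two bits, and the final mark
  \<open>False\<close> one more.\<close>

lemma length_enc_nat: "k < 2 ^ b \<Longrightarrow> length (enc_nat k) \<le> 2 * b + 1"
proof (induction b arbitrary: k)
  case 0
  then show ?case
    by (simp add: enc_nat_0)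
next
  case (Suc b)
  show ?case
  proof (cases "k = 0")
    case False
    have "length (enc_nat (k div 2)) \<le> 2 * b + 1"
      using Suc.prems by (intro Suc.IH) auto
    then show ?thesis
      using False by (simp add: enc_nat_nonzero)
  qed (simp add: enc_nat_0)
qed

lemma length_enc_list:
  assumes "\<And>x. x \<in> set xs \<Longrightarrow> length (enc x) \<le> b"
  shows "length (enc_list enc xs) \<le> length xs * (b + 1) + 1"
  using assms by (induction xs) (fastforce)+


section \<open>Chains of parallel arcs\<close>

lemma law_point: "law [(k, 1)] = return_pmf k"
proof (rule pmf_eqI)
  fix j
  have "pmf_of_list_wf [(k, 1 :: real)]"
    by (simp add: pmf_of_list_wf_def)
  then show "pmf (law [(k, 1)]) j = pmf (return_pmf k) j"
    by (simp add: law_def pmf_pmf_of_list)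
qed

definition chain_value :: "nat \<Rightarrow> nat" where
  "chain_value a = (if odd a then 2 ^ (a div 2) else 0)"

text \<open>Constant arcs make the law of a path a point mass at its length, so different lengths
  mean different laws. Powers of two yield 2^n lengths from values of O(n) bits.\<close>

definition chain :: "nat \<Rightarrow> instnc" where
  "chain n =
     \<lparr> vertices = [0..<Suc n],
       arc_data = map (\<lambda>a. (a div 2, Suc (a div 2), [(chain_value a, 1)])) [0..<2 * n],
       origin = 0,
       destination = n \<rparr>"

text \<open>The path whose choices are the binary digits of \<open>m\<close>, so that its length is \<open>m\<close>.\<close>

definition chain_arc :: "nat \<Rightarrow> nat \<Rightarrow> nat" where
  "chain_arc m i = 2 * i + of_bool (bit m i)"

definition chain_path :: "nat \<Rightarrow> nat \<Rightarrow> nat list" where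
  "chain_path n m = map (chain_arc m) [0..<n]"

lemma chain_arc_div: "chain_arc m i div 2 = i"
  by (simp add: chain_arc_def)

lemma chain_arc_less: "i < n \<Longrightarrow> chain_arc m i < 2 * n"
  by (simp add: chain_arc_def of_bool_def)

lemma valid_chain: "valid_instance (chain n)"
proof -
  have "fin_digraph (graph_of (chain n))" "loopfree_digraph (graph_of (chain n))"
    by (unfold_locales; auto simp: graph_of_def chain_def)+
  then show ?thesis
    by (auto simp: valid_instance_def graph_of_def chain_def valid_dist_def)
qed

lemma is_solution_chain_path: "is_solution (chain n) (chain_path n m)"
proof -
  let ?G = "graph_of (chain n)"
  have ends: "tail ?G (chain_arc m i) = i" "head ?G (chain_arc m i) = Suc i" if "i < n" for i
    using chain_arc_less[OF that, of m]
    by (simp_all add: graph_of_def chain_def chain_arc_div)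
  \<comment> \<open>Generalised to the part of the path from vertex \<open>i\<close> on, by downward
    induction from \<open>n\<close>. The vertex sequence is tracked because an elementary path needs
    distinct vertices.\<close>
  have *: "pre_digraph.cas ?G i (map (chain_arc m) [i..<n]) n \<and>
      pre_digraph.awalk_verts ?G i (map (chain_arc m) [i..<n]) = [i..<Suc n]" if "i \<le> n" for i
    using that
  proof (induction rule: inc_induct)
    case base
    show ?case
      by (simp add: pre_digraph.cas.simps pre_digraph.awalk_verts.simps)
  next
    case (step i)
    then show ?case
      by (simp add: upt_conv_Cons pre_digraph.cas.simps pre_digraph.awalk_verts.simps ends
          del: upt_Suc)
  qed
  have "set (chain_path n m) \<subseteq> arcs ?G"
    using chain_arc_less by (auto simp: chain_path_def graph_of_def chain_def)
  moreover have "0 \<in> verts ?G"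
    by (auto simp: graph_of_def chain_def simp del: upt_Suc)
  ultimately show ?thesis
    using *[of 0]
    by (simp add: is_solution_def pre_digraph.apath_def pre_digraph.awalk_def chain_path_def)
       (simp add: chain_def)
qed

lemma path_law_chain_path:
  assumes "m < 2 ^ n"
  shows "path_law (chain n) (chain_path n m) = return_pmf m"
proof -
  let ?A = "{..<2 * n}"
  have "Pi_pmf ?A 0 (arc_law (chain n)) = Pi_pmf ?A 0 (\<lambda>a. return_pmf (chain_value a))"
    by (rule Pi_pmf_cong) (auto simp: arc_law_def chain_def law_point)
  also have "\<dots> = return_pmf (\<lambda>a. if a \<in> ?A then chain_value a else 0)"
    by (rule Pi_pmf_return_pmf) simp
  finally have "path_law (chain n) (chain_path n m) =
      return_pmf (\<Sum>a\<in>set (chain_path n m). if a \<in> ?A then chain_value a else 0)"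
    by (simp add: path_law_def graph_of_def chain_def)
  moreover have "(\<Sum>a\<in>set (chain_path n m). if a \<in> ?A then chain_value a else 0) = m"
  proof -
    have "inj_on (chain_arc m) {..<n}"
      by (rule inj_on_inverseI[where g = "\<lambda>a. a div 2"]) (rule chain_arc_div)
    then have "(\<Sum>a\<in>set (chain_path n m). if a \<in> ?A then chain_value a else 0) =
        (\<Sum>i<n. if chain_arc m i \<in> ?A then chain_value (chain_arc m i) else 0)"
      by (simp add: chain_path_def atLeast0LessThan sum.reindex)
    \<comment> \<open>Pair \<open>i\<close> contributes 2^i exactly if bit \<open>i\<close> of
      \<open>m\<close> is set. The default value 0 never intervenes, as all chosen arcs lie in
      \<open>?A\<close>.\<close>
    also have "\<dots> = (\<Sum>i<n. push_bit i (of_bool (bit m i)))"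
      using chain_arc_less
      by (intro sum.cong) (auto simp: chain_value_def chain_arc_def push_bit_eq_mult)
    also have "\<dots> = take_bit n m"
      by (simp add: take_bit_sum atLeast0LessThan)
    finally show ?thesis
      using assms by (simp add: take_bit_nat_eq_self)
  qed
  ultimately show ?thesis
    by simp
qed

lemma length_enc_chain: "length (enc_instance (chain n)) \<le> 50 * (n + 1)\<^sup>2"
proof -
  have nat: "length (enc_nat k) \<le> 2 * n + 1" if "k \<le> n" for k
    by (rule length_enc_nat) (use that in \<open>simp add: le_less_trans\<close>)
  have val: "length (enc_nat (chain_value a)) \<le> 2 * n + 1" if "a < 2 * n" for a
  proof (rule length_enc_nat)
    have "a div 2 < n"
      using that by simp
    then show "chain_value a < 2 ^ n"
      by (simp add: chain_value_def)
  qed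
  have one: "length (enc_rat 1) = 6"
    by (simp add: enc_rat_def enc_nat_nonzero enc_nat_0)
  have "length (enc_list enc_nat [0..<Suc n]) \<le> Suc n * ((2 * n + 1) + 1) + 1"
    using length_enc_list[of "[0..<Suc n]" enc_nat "2 * n + 1"] nat by (simp del: upt_Suc)
  moreover have "length (enc_list (\<lambda>(u, v, D). enc_nat u @ enc_nat v @ enc_dist D)
      (arc_data (chain n))) \<le> 2 * n * ((6 * n + 11) + 1) + 1"
  proof -
    \<comment> \<open>Tail, head and value take \<open>2 * n + 1\<close> bits each, the probability
      1 takes 6, and the two list marks of the one-point support take 2.\<close>
    have "length ((\<lambda>(u, v, D). enc_nat u @ enc_nat v @ enc_dist D) x) \<le> 6 * n + 11"
      if x: "x \<in> set (arc_data (chain n))" for x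
    proof -
      obtain a where "a < 2 * n" "x = (a div 2, Suc (a div 2), [(chain_value a, 1)])"
        using x by (auto simp: chain_def)
      moreover from this have "a div 2 \<le> n" "Suc (a div 2) \<le> n"
        by auto
      ultimately show ?thesis
        using nat[of "a div 2"] nat[of "Suc (a div 2)"] val[of a] one by (simp add: enc_dist_def)
    qed
    then have "length (enc_list (\<lambda>(u, v, D). enc_nat u @ enc_nat v @ enc_dist D)
        (arc_data (chain n))) \<le> length (arc_data (chain n)) * ((6 * n + 11) + 1) + 1"
      by (rule length_enc_list)
    then show ?thesis
      by (simp add: chain_def)
  qed
  moreover have "length (enc_nat 0) \<le> 2 * n + 1" "length (enc_nat n) \<le> 2 * n + 1"
    by (rule nat; simp)+
  ultimately have "length (enc_instance (chain n)) \<le>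
      (Suc n * ((2 * n + 1) + 1) + 1) + (2 * n * ((6 * n + 11) + 1) + 1) +
      ((2 * n + 1) + (2 * n + 1))"
    unfolding enc_instance_def length_append by (auto simp: chain_def simp del: upt_Suc)
  also have "\<dots> \<le> 50 * (n + 1)\<^sup>2"
    by (simp add: power2_eq_square algebra_simps)
  finally show ?thesis .
qed


section \<open>Polynomials and exponentials\<close>

text \<open>Horner's scheme raises the exponent by one per coefficient, and \<open>1 \<le> y\<close>
  absorbs the constant term. The separate \<open>y\<close> allows an upper bound on the instance
  size to replace the size itself.\<close>

lemma poly_nat_bound:
  fixes p :: "nat poly"
  obtains C k where "\<And>x y. x \<le> y \<Longrightarrow> 1 \<le> y \<Longrightarrow> poly p x \<le> C * y ^ k"
proof -
  have "\<exists>C k. \<forall>x y. x \<le> y \<longrightarrow> 1 \<le> y \<longrightarrow> poly p x \<le> C * y ^ k"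
  proof (induction p)
    case 0
    then show ?case
      by simp
  next
    case (pCons a p)
    then obtain C k where Ck: "\<And>x y. x \<le> y \<Longrightarrow> 1 \<le> y \<Longrightarrow> poly p x \<le> C * y ^ k"
      by blast
    have "poly (pCons a p) x \<le> (a + C) * y ^ Suc k" if "x \<le> y" "1 \<le> y" for x y
    proof -
      have "x * poly p x \<le> y * (C * y ^ k)"
        using that Ck by (intro mult_mono) auto
      moreover have "a * 1 \<le> a * y ^ Suc k"
        using that by (intro mult_left_mono one_le_power) auto
      ultimately have "a * 1 + x * poly p x \<le> a * y ^ Suc k + y * (C * y ^ k)"
        by (rule add_mono[rotated])
      then show ?thesis
        by (simp add: algebra_simps)
    qed
    then show ?case
      by blast
  qed
  then show ?thesis
    using that by blast
qed

text \<open>The summand 1 on the left reserves room for the law of the returned path, next to one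
  law per step.\<close>

lemma poly_less_two_power:
  fixes p :: "nat poly"
  obtains n where "\<And>x. x \<le> 50 * (n + 1)\<^sup>2 \<Longrightarrow> poly p x + 1 < 2 ^ n"
proof -
  obtain C k where Ck: "\<And>x y. x \<le> y \<Longrightarrow> 1 \<le> y \<Longrightarrow> poly p x \<le> C * y ^ k"
    using poly_nat_bound by blast
  have "(\<lambda>n. (real C * (50 * (real n + 1)\<^sup>2) ^ k + 1) / 2 ^ n) \<longlonglongrightarrow> 0"
    by real_asymp
  then have "\<forall>\<^sub>F n in sequentially. (real C * (50 * (real n + 1)\<^sup>2) ^ k + 1) / 2 ^ n < 1"
    by (rule order_tendstoD) simp
  then obtain n where "(real C * (50 * (real n + 1)\<^sup>2) ^ k + 1) / 2 ^ n < 1"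
    using eventually_happens by force
  then have "real (C * (50 * (n + 1)\<^sup>2) ^ k + 1) < real (2 ^ n)"
    by (simp add: divide_simps add.commute)
  then have n: "C * (50 * (n + 1)\<^sup>2) ^ k + 1 < 2 ^ n"
    by (simp only: of_nat_less_iff)
  show ?thesis
  proof
    fix x
    assume "x \<le> 50 * (n + 1)\<^sup>2"
    then have "poly p x \<le> C * (50 * (n + 1)\<^sup>2) ^ k"
      by (rule Ck) simp
    then show "poly p x + 1 < 2 ^ n"
      using n by simp
  qed
qed


section \<open>The adversary argument\<close>

lemma not_solves_all_measures:
  assumes "t + 1 < 2 ^ n"
  shows "\<exists>\<rho>. \<not> solves_within M \<rho> (chain n) t"
proof (rule ccontr)
  assume "\<nexists>\<rho>. \<not> solves_within M \<rho> (chain n) t"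
  then have solves: "solves_within M \<rho> (chain n) t" for \<rho>
    by blast
  let ?w = "enc_instance (chain n)"
  let ?f = "risk_query (\<lambda>_. 0)"
  obtain r where r: "outputs_within M ?f ?w t (enc_output r)"
      "case r of Some P \<Rightarrow> is_optimal (\<lambda>_. 0) (chain n) P | None \<Rightarrow> \<nexists>P. is_solution (chain n) P"
    using solves unfolding solves_within_def by blast
  then obtain P where P: "r = Some P"
    using is_solution_chain_path by (cases r) auto
  \<comment> \<open>At words that encode no distribution, \<open>THE\<close> yields some arbitrary
    law. This is harmless, since \<open>L\<close> only has to contain the queried laws and have at
    most \<open>t\<close> elements.\<close>
  define L where
    "L = (\<lambda>v. law (THE D. valid_dist D \<and> enc_dist D = v)) ` queries M ?f ?w t"
  define F where "F = insert (path_law (chain n) P) L"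
  have "card L \<le> t"
    unfolding L_def using card_image_le[OF finite_queries] card_queries order.trans by blast
  then have "card F \<le> t + 1"
    by (simp add: F_def L_def finite_queries card_insert_if)
  moreover have "card (return_pmf ` {..<2 ^ n :: nat}) = 2 ^ n"
    by (simp add: card_image inj_on_def)
  moreover have "finite F"
    by (simp add: F_def L_def finite_queries)
  ultimately have "\<not> return_pmf ` {..<2 ^ n :: nat} \<subseteq> F"
    using assms card_mono[of F "return_pmf ` {..<2 ^ n}"] by linarith
  then obtain m where m: "m < 2 ^ n" "return_pmf m \<notin> F"
    by blast
  define \<rho> :: risk_measure where "\<rho> = (\<lambda>\<mu>. if \<mu> = return_pmf m then -1 else 0)"
  \<comment> \<open>A query encoding a distribution has its law in \<open>F\<close>, hence not the
    law with risk -1; any other word is answered by 0 for both measures.\<close>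
  have "?f v = risk_query \<rho> v" if "v \<in> queries M ?f ?w t" for v
  proof -
    have "law (THE D. valid_dist D \<and> enc_dist D = v) \<in> F"
      using that by (simp add: F_def L_def)
    then show ?thesis
      using m(2) by (auto simp: risk_query_def \<rho>_def)
  qed
  then have out: "outputs_within M (risk_query \<rho>) ?w t (enc_output (Some P))"
    using r(1) outputs_within_cong P by blast
  obtain s where s: "outputs_within M (risk_query \<rho>) ?w t (enc_output s)"
      "case s of Some P \<Rightarrow> is_optimal \<rho> (chain n) P | None \<Rightarrow> \<nexists>P. is_solution (chain n) P"
    using solves unfolding solves_within_def by blast
  \<comment> \<open>Success on \<open>\<rho>\<close> might come with another answer
    \<open>s\<close>, but the machine is deterministic and the output word determines the
    answer.\<close>
  have "s = Some P"
    by (rule inj_enc_output, rule outputs_within_unique[OF s(1) out])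
  then have "is_optimal \<rho> (chain n) P"
    using s(2) by simp
  then have "\<not> \<rho> (path_law (chain n) (chain_path n m)) < \<rho> (path_law (chain n) P)"
    using is_solution_chain_path by (auto simp: is_optimal_def is_arg_min_def)
  moreover have "path_law (chain n) P \<noteq> return_pmf m"
    using m(2) by (auto simp: F_def)
  ultimately show False
    by (simp add: \<rho>_def path_law_chain_path m(1))
qed

theorem theorem1:
  assumes "class_P \<noteq> class_NP"
  shows "\<not> (\<exists>M (p :: nat poly). wf_machine M \<and>
           (\<forall>(\<rho> :: risk_measure) I. valid_instance I \<longrightarrow>
              solves_within M \<rho> I (poly p (length (enc_instance I)))))"
proof
  assume "\<exists>M (p :: nat poly). wf_machine M \<and>
           (\<forall>(\<rho> :: risk_measure) I. valid_instance I \<longrightarrow>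
              solves_within M \<rho> I (poly p (length (enc_instance I))))"
  then obtain M and p :: "nat poly" where
    M: "\<And>\<rho> I. valid_instance I \<Longrightarrow> solves_within M \<rho> I (poly p (length (enc_instance I)))"
    by blast
  \<comment> \<open>The size \<open>n\<close> depends on the time bound \<open>p\<close> only; the
    risk measure is chosen afterwards, against \<open>M\<close>.\<close>
  obtain n where "\<And>x. x \<le> 50 * (n + 1)\<^sup>2 \<Longrightarrow> poly p x + 1 < 2 ^ n"
    using poly_less_two_power by blast
  then have "poly p (length (enc_instance (chain n))) + 1 < 2 ^ n"
    using length_enc_chain by blast
  then show False
    using not_solves_all_measures M valid_chain by blast
qed

end
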